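(* Let $\alpha,\beta\in\mathbb R$ with $\beta\ge0$ and $\alpha>-\beta$, and let $\mathbf h^{\alpha\beta}$ be the left-invariant metric on the horizontal sub-bundle $\mathcal H$ of $T\,\mathrm{Diff}\,S^1$ obtained by left translation of $\langle x,y\rangle^{\alpha\beta}_0=\frac1{2\pi}\int_0^{2\pi}(\alpha xy+\beta x'y')\,d\theta$ on $\mathrm{Vect}_0S^1$. If $\gamma\colon I\to\mathrm{Diff}\,S^1$ is a normal sub-Riemannian geodesic for $\mathbf h^{\alpha\beta}$, then its left logarithmic derivative $u$ satisfies, for some constant $\lambda\in\mathbb R$, $$\beta\dot u''-\alpha\dot u=\beta(uu'''+2u'u'')-3\alpha uu'-2\lambda u'.$$
   Context: $I=[0,1]$; $'=\partial_\theta$, $\dot{}=\partial_t$; curves are smooth. $\mathrm{Diff}\,S^1$ is the Fréchet Lie group of orientation preserving diffeomorphisms of $S^1=\mathbb R/2\pi\mathbb Z$, with Lie algebra $\mathrm{Vect}\,S^1\cong C^\infty(S^1)$ (identify $x\,\partial_\theta$ with $x$), bracket $[x,y]=x'y-y'x$. The left logarithmic derivative of $\gamma$ is $\kappa^\ell(\dot\gamma)=\dot\gamma/\gamma'$. $\eta(x)=\frac1{2\pi}\int_0^{2\pi}x\,d\theta$, $\mathrm{Vect}_0S^1=\ker\eta$, and $\mathfrak k$ is the space of constant vector fields, so $\mathrm{Vect}\,S^1=\mathrm{Vect}_0S^1\oplus\mathfrak k$. $\mathcal H$ is the sub-bundle obtained by left translations of $\mathrm{Vect}_0S^1$. The inner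 product is extended to $\mathrm{Vect}\,S^1$ by $\langle x,y\rangle^{\alpha\beta}=\langle x-\eta(x),y-\eta(y)\rangle_0^{\alpha\beta}+\eta(x)\eta(y)$; $\mathrm{ad}_x^\top$ denotes the adjoint of $\mathrm{ad}_x\colon y\mapsto[x,y]$ with respect to this extension. A normal sub-Riemannian geodesic is a horizontal critical curve of the energy $\frac12\int_0^1\mathbf h^{\alpha\beta}(\dot\gamma,\dot\gamma)dt$ with respect to horizontal variations fixing the endpoints, such that $u=\kappa^\ell(\dot\gamma)\in\mathrm{Vect}_0S^1$ satisfies $\dot u=\mathrm{pr}_{\mathrm{Vect}_0S^1}\mathrm{ad}_u^\top(u+\lambda)$, $\dot\lambda=\mathrm{pr}_{\mathfrak k}\mathrm{ad}_u^\top(u+\lambda)$ for some smooth curve $\lambda\colon I\to\mathfrak k$. *)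

theory Defs
  imports "HOL-Analysis.Analysis"
begin

text \<open>
  Smoothness on a set \<open>S\<close> that may have boundary points: all iterated directional derivatives
  exist as Frechet derivatives within \<open>S\<close> and are continuous. The sets used below are convex with
  nonempty interior, so the derivative within \<open>S\<close> is unique, also at boundary points.
\<close>

primrec C_on :: "nat \<Rightarrow> 'a::euclidean_space set \<Rightarrow> ('a \<Rightarrow> 'b::real_normed_vector) \<Rightarrow> bool" where
  "C_on 0 S f \<longleftrightarrow> continuous_on S f"
| "C_on (Suc k) S f \<longleftrightarrow>
     (\<exists>D. (\<forall>p\<in>S. (f has_derivative D p) (at p within S)) \<and> (\<forall>v. C_on k S (\<lambda>p. D p v)))"

definition smooth_on :: "'a::euclidean_space set \<Rightarrow> ('a \<Rightarrow> 'b::real_normed_vector) \<Rightarrow> bool" where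
  "smooth_on S f \<longleftrightarrow> (\<forall>k. C_on k S f)"

abbreviation time_deriv :: "(real \<Rightarrow> 'a::real_normed_vector) \<Rightarrow> real \<Rightarrow> 'a" where
  "time_deriv c t \<equiv> vector_derivative c (at t within {0..1})"

text \<open>A vector field \<open>x \<partial>\<^sub>\<theta>\<close> is identified with the \<open>2\<pi>\<close>-periodic function \<open>x\<close> of the angle.\<close>

definition Vect :: "(real \<Rightarrow> real) set" where
  "Vect = {x. smooth_on UNIV x \<and> (\<forall>\<theta>. x (\<theta> + 2 * pi) = x \<theta>)}"

definition mean :: "(real \<Rightarrow> real) \<Rightarrow> real" where
  "mean x = 1 / (2 * pi) * integral {0..2 * pi} x"

definition Vect0 :: "(real \<Rightarrow> real) set" where
  "Vect0 = {x \<in> Vect. mean x = 0}"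

definition pr0 :: "(real \<Rightarrow> real) \<Rightarrow> (real \<Rightarrow> real)" where
  "pr0 x = (\<lambda>\<theta>. x \<theta> - mean x)"

definition bracket :: "(real \<Rightarrow> real) \<Rightarrow> (real \<Rightarrow> real) \<Rightarrow> (real \<Rightarrow> real)" where
  "bracket x y = (\<lambda>\<theta>. deriv x \<theta> * y \<theta> - deriv y \<theta> * x \<theta>)"

definition ip0 :: "real \<Rightarrow> real \<Rightarrow> (real \<Rightarrow> real) \<Rightarrow> (real \<Rightarrow> real) \<Rightarrow> real" where
  "ip0 \<alpha> \<beta> x y =
     1 / (2 * pi) * integral {0..2 * pi} (\<lambda>\<theta>. \<alpha> * x \<theta> * y \<theta> + \<beta> * deriv x \<theta> * deriv y \<theta>)"

definition ip :: "real \<Rightarrow> real \<Rightarrow> (real \<Rightarrow> real) \<Rightarrow> (real \<Rightarrow> real) \<Rightarrow> real" where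
  "ip \<alpha> \<beta> x y = ip0 \<alpha> \<beta> (pr0 x) (pr0 y) + mean x * mean y"

text \<open>
  \<open>is_ad_adjoint \<alpha> \<beta> x y z\<close> says that \<open>z\<close> is the value at \<open>y\<close> of the adjoint of
  \<open>ad\<^sub>x = bracket x\<close> with respect to \<open>ip \<alpha> \<beta>\<close>. For \<open>\<beta> \<ge> 0\<close> and \<open>\<alpha> > -\<beta>\<close> the form is positive
  definite, so there is at most one such \<open>z\<close>.
\<close>

definition is_ad_adjoint ::
    "real \<Rightarrow> real \<Rightarrow> (real \<Rightarrow> real) \<Rightarrow> (real \<Rightarrow> real) \<Rightarrow> (real \<Rightarrow> real) \<Rightarrow> bool" where
  "is_ad_adjoint \<alpha> \<beta> x y z \<longleftrightarrow> z \<in> Vect \<and> (\<forall>w\<in>Vect. ip \<alpha> \<beta> z w = ip \<alpha> \<beta> y (bracket x w))"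

text \<open>
  The circle is the unit circle of the complex plane with angle coordinate \<open>cis\<close>; only the values
  of a map \<open>complex \<Rightarrow> complex\<close> on it matter.
\<close>

abbreviation S1 :: "complex set" where
  "S1 \<equiv> sphere 0 1"

definition angle_deriv :: "(complex \<Rightarrow> complex) \<Rightarrow> real \<Rightarrow> complex" where
  "angle_deriv \<phi> \<theta> = vector_derivative (\<lambda>\<tau>. \<phi> (cis \<tau>)) (at \<theta>)"

text \<open>
  If \<open>\<phi> (cis \<theta>) = cis (f \<theta>)\<close>, then \<open>angle_deriv \<phi> \<theta> = \<i> * f' \<theta> * \<phi> (cis \<theta>)\<close>, so the last
  condition below is \<open>f' > 0\<close>.
\<close>

definition DiffS1 :: "(complex \<Rightarrow> complex) set" where
  "DiffS1 = {\<phi>. bij_betw \<phi> S1 S1 \<and>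
     smooth_on UNIV (\<lambda>\<theta>. \<phi> (cis \<theta>)) \<and>
     smooth_on UNIV (\<lambda>\<theta>. inv_into S1 \<phi> (cis \<theta>)) \<and>
     (\<forall>\<theta>. Im (angle_deriv \<phi> \<theta> / \<phi> (cis \<theta>)) > 0)}"

text \<open>
  A curve \<open>I \<rightarrow> Diff S\<^sup>1\<close> is smooth for the Frechet structure iff it is jointly smooth on
  \<open>I \<times> S\<^sup>1\<close>.
\<close>

definition smooth_curve :: "(real \<Rightarrow> complex \<Rightarrow> complex) \<Rightarrow> bool" where
  "smooth_curve \<gamma> \<longleftrightarrow> (\<forall>t\<in>{0..1}. \<gamma> t \<in> DiffS1) \<and>
     smooth_on ({0..1} \<times> UNIV) (\<lambda>(t, \<theta>). \<gamma> t (cis \<theta>))"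

definition velocity :: "(real \<Rightarrow> complex \<Rightarrow> complex) \<Rightarrow> real \<Rightarrow> complex \<Rightarrow> complex" where
  "velocity \<gamma> t z = time_deriv (\<lambda>s. \<gamma> s z) t"

text \<open>
  A tangent vector at \<open>\<phi>\<close> is a vector field \<open>v\<close> along \<open>\<phi>\<close>. The left translate of \<open>x\<close> to \<open>\<phi>\<close> is
  \<open>v (cis \<theta>) = x \<theta> * angle_deriv \<phi> \<theta>\<close>. For tangential \<open>v\<close> the quotient below is therefore real;
  \<open>Re\<close> only adjusts the type.
\<close>

definition kappa :: "(complex \<Rightarrow> complex) \<Rightarrow> (complex \<Rightarrow> complex) \<Rightarrow> real \<Rightarrow> real" where
  "kappa \<phi> v \<theta> = Re (v (cis \<theta>) / angle_deriv \<phi> \<theta>)"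

definition left_log_deriv :: "(real \<Rightarrow> complex \<Rightarrow> complex) \<Rightarrow> real \<Rightarrow> real \<Rightarrow> real" where
  "left_log_deriv \<gamma> t = kappa (\<gamma> t) (velocity \<gamma> t)"

definition horizontal_curve :: "(real \<Rightarrow> complex \<Rightarrow> complex) \<Rightarrow> bool" where
  "horizontal_curve \<gamma> \<longleftrightarrow> smooth_curve \<gamma> \<and> (\<forall>t\<in>{0..1}. left_log_deriv \<gamma> t \<in> Vect0)"

definition metric_h ::
    "real \<Rightarrow> real \<Rightarrow> (complex \<Rightarrow> complex) \<Rightarrow> (complex \<Rightarrow> complex) \<Rightarrow> (complex \<Rightarrow> complex) \<Rightarrow> real" where
  "metric_h \<alpha> \<beta> \<phi> v w = ip0 \<alpha> \<beta> (kappa \<phi> v) (kappa \<phi> w)"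

definition energy :: "real \<Rightarrow> real \<Rightarrow> (real \<Rightarrow> complex \<Rightarrow> complex) \<Rightarrow> real" where
  "energy \<alpha> \<beta> \<gamma> =
     1 / 2 * integral {0..1} (\<lambda>t. metric_h \<alpha> \<beta> (\<gamma> t) (velocity \<gamma> t) (velocity \<gamma> t))"

definition horizontal_variation ::
    "(real \<Rightarrow> complex \<Rightarrow> complex) \<Rightarrow> real \<Rightarrow> (real \<Rightarrow> real \<Rightarrow> complex \<Rightarrow> complex) \<Rightarrow> bool" where
  "horizontal_variation \<gamma> \<epsilon> \<Gamma> \<longleftrightarrow>
     smooth_on ({-\<epsilon><..<\<epsilon>} \<times> {0..1} \<times> UNIV) (\<lambda>(s, t, \<theta>). \<Gamma> s t (cis \<theta>)) \<and>
     (\<forall>s\<in>{-\<epsilon><..<\<epsilon>}. horizontal_curve (\<Gamma> s)) \<and>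
     (\<forall>t\<in>{0..1}. \<forall>z\<in>S1. \<Gamma> 0 t z = \<gamma> t z) \<and>
     (\<forall>s\<in>{-\<epsilon><..<\<epsilon>}. \<forall>z\<in>S1. \<Gamma> s 0 z = \<gamma> 0 z \<and> \<Gamma> s 1 z = \<gamma> 1 z)"

definition critical_curve :: "real \<Rightarrow> real \<Rightarrow> (real \<Rightarrow> complex \<Rightarrow> complex) \<Rightarrow> bool" where
  "critical_curve \<alpha> \<beta> \<gamma> \<longleftrightarrow>
     (\<forall>\<epsilon>>0. \<forall>\<Gamma>. horizontal_variation \<gamma> \<epsilon> \<Gamma> \<longrightarrow>
        ((\<lambda>s. energy \<alpha> \<beta> (\<Gamma> s)) has_real_derivative 0) (at 0))"

text \<open>The constant vector fields are identified with the reals, so that \<open>mean\<close> is the projection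
  onto them.\<close>

definition normal_geodesic :: "real \<Rightarrow> real \<Rightarrow> (real \<Rightarrow> complex \<Rightarrow> complex) \<Rightarrow> bool" where
  "normal_geodesic \<alpha> \<beta> \<gamma> \<longleftrightarrow>
     horizontal_curve \<gamma> \<and> critical_curve \<alpha> \<beta> \<gamma> \<and>
     (let u = left_log_deriv \<gamma> in
      \<exists>l::real \<Rightarrow> real. smooth_on {0..1} l \<and>
        (\<forall>t\<in>{0..1}. \<exists>z. is_ad_adjoint \<alpha> \<beta> (u t) (\<lambda>\<theta>. u t \<theta> + l t) z \<and>
           (\<forall>\<theta>. time_deriv (\<lambda>s. u s \<theta>) t = pr0 z \<theta>) \<and>
           time_deriv l t = mean z))"

end

theory Submission
  imports Defs
begin

text \<open>
  In terms of the \<open>L\<^sup>2\<close> product the extended form is \<open>ip x y = mean (A x * y)\<close> with the inertia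
  operator \<open>A x = \<alpha> (x - mean x) - \<beta> x'' + mean x\<close>, and integration by parts moves the bracket
  with \<open>u\<close> to the other factor, \<open>mean (a * bracket u w) = mean ((2 a u' + a' u) * w)\<close>.
  Hence \<open>z\<close> is the value of the adjoint at \<open>u + l\<close> iff \<open>A z = 2 a u' + a' u\<close> where
  \<open>a = A (u + l) = \<alpha> u - \<beta> u'' + l\<close>. The mean of the right-hand side vanishes since \<open>a u'\<close> is a
  derivative; so \<open>l\<close> is constant in time, \<open>z\<close> is the time derivative of \<open>u\<close>, and the equation
  becomes the claimed one.
\<close>

section \<open>Closure properties of smooth functions\<close>

lemma C_on_SucD: "C_on (Suc k) S f \<Longrightarrow> C_on k S f"
proof (induction k arbitrary: f)
  case 0
  then show ?case
    by (auto intro!: continuous_at_imp_continuous_on simp: continuous_on_eq_continuous_within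
        intro: has_derivative_continuous)
next
  case (Suc k)
  then show ?case by (metis C_on.simps(2))
qed

lemma C_on_const: "C_on k S (\<lambda>_. c)"
proof (induction k arbitrary: c)
  case (Suc k)
  then show ?case
    by (auto intro!: exI[of _ "\<lambda>_ _. 0"])
qed simp

lemma C_on_add: "C_on k S f \<Longrightarrow> C_on k S g \<Longrightarrow> C_on k S (\<lambda>p. f p + g p)"
proof (induction k arbitrary: f g)
  case (Suc k)
  then obtain D E where "\<forall>p\<in>S. (f has_derivative D p) (at p within S)" "\<forall>v. C_on k S (\<lambda>p. D p v)"
    "\<forall>p\<in>S. (g has_derivative E p) (at p within S)" "\<forall>v. C_on k S (\<lambda>p. E p v)"
    by auto
  with Suc.IH show ?case
    by (auto intro!: exI[of _ "\<lambda>p v. D p v + E p v"] derivative_intros)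
qed (simp add: continuous_on_add)

lemma C_on_mult:
  fixes f g :: "'a::euclidean_space \<Rightarrow> 'b::real_normed_algebra"
  shows "C_on k S f \<Longrightarrow> C_on k S g \<Longrightarrow> C_on k S (\<lambda>p. f p * g p)"
proof (induction k arbitrary: f g)
  case (Suc k)
  then obtain D E where "\<forall>p\<in>S. (f has_derivative D p) (at p within S)" "\<forall>v. C_on k S (\<lambda>p. D p v)"
    "\<forall>p\<in>S. (g has_derivative E p) (at p within S)" "\<forall>v. C_on k S (\<lambda>p. E p v)"
    by auto
  \<comment> \<open>The product rule leaves \<open>f\<close> and \<open>g\<close> undifferentiated
    as factors, so they are needed at order \<open>k\<close> as well as their derivatives.\<close>
  with Suc.IH C_on_SucD[OF Suc.prems(1)] C_on_SucD[OF Suc.prems(2)] show ?case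
    by (auto intro!: exI[of _ "\<lambda>p v. f p * E p v + D p v * g p"] derivative_intros C_on_add)
qed (simp add: continuous_on_mult)

lemma smooth_on_UNIV_deriv:
  fixes x :: "real \<Rightarrow> real"
  assumes "smooth_on UNIV x"
  shows "(x has_real_derivative deriv x \<theta>) (at \<theta>)" and "smooth_on UNIV (deriv x)"
proof -
  have *: "(x has_real_derivative deriv x \<theta>) (at \<theta>) \<and> C_on k UNIV (deriv x)" for k \<theta>
  proof -
    from assms have "C_on (Suc k) UNIV x" by (simp only: smooth_on_def)
    then obtain D where D': "\<forall>p\<in>UNIV. (x has_derivative D p) (at p)"
      and C': "\<forall>v. C_on k UNIV (\<lambda>p. D p v)"
      unfolding C_on.simps by (elim exE conjE)
    have D: "(x has_derivative D p) (at p)" for p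
      using D' by (rule bspec) (rule UNIV_I)
    \<comment> \<open>On the line a linear map is multiplication by its value at 1, so the
      directional derivative in direction 1 is \<open>deriv x\<close>.\<close>
    have C: "C_on k UNIV (\<lambda>p. D p 1)"
      using C' by (rule spec)
    have "(x has_real_derivative D p 1) (at p)" for p
    proof -
      have "D p v = D p 1 * v" for v
        using linear_cmul[OF has_derivative_linear[OF D[of p]], of v 1] by (simp only: real_scaleR_def mult_1_right mult.commute[of v])
      then have "D p = (*) (D p 1)" ..
      then show ?thesis
        unfolding has_field_derivative_def by (rule has_derivative_eq_rhs[OF D])
    qed
    moreover from this have "deriv x = (\<lambda>p. D p 1)"
      by (auto intro: DERIV_imp_deriv)
    ultimately show ?thesis using C by simp
  qed
  show "(x has_real_derivative deriv x \<theta>) (at \<theta>)" "smooth_on UNIV (deriv x)"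
    using * by (auto simp: smooth_on_def)
qed

section \<open>\<open>Vect\<close> as an algebra closed under differentiation\<close>

lemma Vect_DERIV: "x \<in> Vect \<Longrightarrow> (x has_real_derivative deriv x \<theta>) (at \<theta>)"
  by (auto simp: Vect_def intro: smooth_on_UNIV_deriv)

lemma Vect_deriv: assumes "x \<in> Vect" shows "deriv x \<in> Vect"
proof -
  have "deriv x (\<theta> + 2 * pi) = deriv x \<theta>" for \<theta>
  proof -
    have "((\<lambda>\<theta>. x (\<theta> + 2 * pi)) has_real_derivative deriv x (\<theta> + 2 * pi)) (at \<theta>)"
      using Vect_DERIV[OF assms, of "\<theta> + 2 * pi"] by (simp only: DERIV_shift)
    then show ?thesis
      using assms by (auto simp: Vect_def intro!: DERIV_imp_deriv[symmetric])
  qed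
  with assms show ?thesis
    by (auto simp: Vect_def intro: smooth_on_UNIV_deriv)
qed

lemma Vect_const: "(\<lambda>_. c) \<in> Vect"
  by (simp add: Vect_def smooth_on_def C_on_const)

lemma Vect_add: "x \<in> Vect \<Longrightarrow> y \<in> Vect \<Longrightarrow> (\<lambda>\<theta>. x \<theta> + y \<theta>) \<in> Vect"
  by (simp add: Vect_def smooth_on_def C_on_add)

lemma Vect_mult: "x \<in> Vect \<Longrightarrow> y \<in> Vect \<Longrightarrow> (\<lambda>\<theta>. x \<theta> * y \<theta>) \<in> Vect"
  by (simp add: Vect_def smooth_on_def C_on_mult)

lemma Vect_diff: "x \<in> Vect \<Longrightarrow> y \<in> Vect \<Longrightarrow> (\<lambda>\<theta>. x \<theta> - y \<theta>) \<in> Vect"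
  using Vect_add[OF _ Vect_mult[OF Vect_const[of "-1"]], of x y] by simp

lemmas Vect_intros = Vect_const Vect_add Vect_diff Vect_mult Vect_deriv

lemma Vect_continuous_on: "x \<in> Vect \<Longrightarrow> continuous_on A x"
  by (meson Vect_DERIV DERIV_isCont continuous_at_imp_continuous_on)

lemma Vect_integrable: "x \<in> Vect \<Longrightarrow> x integrable_on {a..b}"
  by (intro integrable_continuous_real Vect_continuous_on)

section \<open>The mean over a period and the L2 product on \<open>Vect\<close>\<close>

lemma mean_const: "mean (\<lambda>_. c) = c"
  by (simp add: mean_def)

lemma mean_add: "x \<in> Vect \<Longrightarrow> y \<in> Vect \<Longrightarrow> mean (\<lambda>\<theta>. x \<theta> + y \<theta>) = mean x + mean y"
  by (simp add: mean_def integral_add Vect_integrable algebra_simps add_divide_distrib)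

lemma mean_diff: "x \<in> Vect \<Longrightarrow> y \<in> Vect \<Longrightarrow> mean (\<lambda>\<theta>. x \<theta> - y \<theta>) = mean x - mean y"
  by (simp add: mean_def integral_diff Vect_integrable algebra_simps diff_divide_distrib)

lemma mean_cmult: "mean (\<lambda>\<theta>. c * x \<theta>) = c * mean x"
  by (simp add: mean_def)

lemmas mean_simps = mean_add mean_diff mean_cmult mean_const Vect_intros

text \<open>By periodicity the boundary terms in the fundamental theorem of calculus cancel.\<close>

lemma mean_DERIV:
  assumes "x \<in> Vect" and "\<And>\<theta>. (x has_real_derivative y \<theta>) (at \<theta>)"
  shows "mean y = 0"
proof -
  have "(y has_integral x (2 * pi) - x 0) {0..2 * pi}"
    by (rule fundamental_theorem_of_calculus)
      (auto intro: has_field_derivative_at_within assms(2)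
        simp flip: has_real_derivative_iff_has_vector_derivative)
  moreover have "x (2 * pi) = x 0"
    using assms(1) by (auto simp: Vect_def dest: spec[of _ 0])
  ultimately show ?thesis
    by (simp add: mean_def integral_unique)
qed

lemma mean_by_parts:
  assumes "x \<in> Vect" "y \<in> Vect"
  shows "mean (\<lambda>\<theta>. deriv x \<theta> * y \<theta>) = - mean (\<lambda>\<theta>. x \<theta> * deriv y \<theta>)"
proof -
  have "mean (\<lambda>\<theta>. deriv x \<theta> * y \<theta> + x \<theta> * deriv y \<theta>) = 0"
    by (rule mean_DERIV[OF Vect_mult[OF assms]])
      (auto intro!: derivative_eq_intros Vect_DERIV assms)
  then show ?thesis
    by (simp add: mean_simps assms)
qed

text \<open>Definiteness of the L2 product: a continuous nonnegative integrand with zero integral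
  vanishes on one period, and periodicity carries this to the whole line.\<close>

lemma Vect_eq_0_if_mean_square:
  assumes "x \<in> Vect" and "mean (\<lambda>\<theta>. x \<theta> * x \<theta>) = 0"
  shows "x \<theta> = 0"
proof -
  have on_period: "x t = 0" if "t \<in> {0..2 * pi}" for t
  proof -
    have "((\<lambda>\<theta>. x \<theta> * x \<theta>) has_integral 0) (cbox 0 (2 * pi))"
      using assms(2) integrable_integral[OF Vect_integrable[OF Vect_mult[OF assms(1,1)], of 0 "2 * pi"]]
      by (simp add: mean_def)
    then have "x t * x t = 0"
      by (rule has_integral_0_cbox_imp_0[rotated 2])
        (use that in \<open>auto simp: not_le intro!: Vect_continuous_on Vect_mult assms(1)\<close>)
    then show ?thesis by simp
  qed
  \<comment> \<open>The number of whole periods to subtract to bring \<open>\<theta>\<close> into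
    the interval from 0 to 2 pi.\<close>
  define k where "k = \<lfloor>\<theta> / (2 * pi)\<rfloor>"
  \<comment> \<open>\<open>\<theta>\<close> may be negative, hence the induction on integers in both
    directions.\<close>
  have shift: "x (t + of_int m * (2 * pi)) = x t" for t m
  proof (induction m rule: int_induct[of _ 0])
    case (step1 i)
    have "x (t + of_int (i + 1) * (2 * pi)) = x ((t + of_int i * (2 * pi)) + 2 * pi)"
      by (simp add: algebra_simps)
    with step1 assms(1) show ?case by (simp add: Vect_def)
  next
    case (step2 i)
    have "x (t + of_int i * (2 * pi)) = x ((t + of_int (i - 1) * (2 * pi)) + 2 * pi)"
      by (simp add: algebra_simps)
    with step2 assms(1) show ?case by (simp add: Vect_def)
  qed simp
  have "of_int k \<le> \<theta> / (2 * pi)" "\<theta> / (2 * pi) \<le> of_int k + 1"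
    unfolding k_def by linarith+
  then have "\<theta> - of_int k * (2 * pi) \<in> {0..2 * pi}"
    by (simp add: field_simps)
  with on_period shift[of "\<theta> - of_int k * (2 * pi)" k] show ?thesis by simp
qed

text \<open>Testing against \<open>x - y\<close> itself reduces this to definiteness. It turns the
  weak identity defining the adjoint into an equality of functions.\<close>

lemma Vect_eqI_mean:
  assumes "x \<in> Vect" "y \<in> Vect"
    and "\<And>w. w \<in> Vect \<Longrightarrow> mean (\<lambda>\<theta>. x \<theta> * w \<theta>) = mean (\<lambda>\<theta>. y \<theta> * w \<theta>)"
  shows "x = y"
proof
  fix \<theta>
  let ?w = "\<lambda>\<theta>. x \<theta> - y \<theta>"
  have "mean (\<lambda>\<theta>. ?w \<theta> * ?w \<theta>) = mean (\<lambda>\<theta>. x \<theta> * ?w \<theta> - y \<theta> * ?w \<theta>)"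
    by (simp add: algebra_simps)
  also have "\<dots> = 0"
    using assms by (subst mean_diff) (auto intro!: Vect_intros)
  finally have "?w \<theta> = 0"
    by (rule Vect_eq_0_if_mean_square[rotated]) (intro Vect_intros assms)
  then show "x \<theta> = y \<theta>" by simp
qed

section \<open>The inertia operator and the adjoint of the bracket\<close>

lemma deriv_Vect_minus_const: "x \<in> Vect \<Longrightarrow> deriv (\<lambda>\<theta>. x \<theta> - c) = deriv x"
  by (rule ext, rule DERIV_imp_deriv) (auto intro!: derivative_eq_intros Vect_DERIV)

lemma deriv_Vect_add_const: "x \<in> Vect \<Longrightarrow> deriv (\<lambda>\<theta>. x \<theta> + c) = deriv x"
  using deriv_Vect_minus_const[of x "-c"] by simp

definition inertia :: "real \<Rightarrow> real \<Rightarrow> (real \<Rightarrow> real) \<Rightarrow> (real \<Rightarrow> real)" where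
  "inertia \<alpha> \<beta> x = (\<lambda>\<theta>. \<alpha> * (x \<theta> - mean x) - \<beta> * deriv (deriv x) \<theta> + mean x)"

lemma Vect_inertia: "x \<in> Vect \<Longrightarrow> inertia \<alpha> \<beta> x \<in> Vect"
  unfolding inertia_def by (intro Vect_intros)

text \<open>Since \<open>x - mean x\<close> has mean zero, centring \<open>y\<close> changes nothing
  in the \<alpha> term; one integration by parts moves the derivative from \<open>y\<close> onto
  \<open>deriv x\<close>.\<close>

lemma ip_eq_mean_inertia:
  assumes "x \<in> Vect" "y \<in> Vect"
  shows "ip \<alpha> \<beta> x y = mean (\<lambda>\<theta>. inertia \<alpha> \<beta> x \<theta> * y \<theta>)"
proof -
  have xy: "(\<lambda>\<theta>. x \<theta> * y \<theta>) \<in> Vect" "(\<lambda>\<theta>. deriv x \<theta> * deriv y \<theta>) \<in> Vect"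
    "(\<lambda>\<theta>. deriv (deriv x) \<theta> * y \<theta>) \<in> Vect"
    by (intro Vect_intros assms)+
  have "ip \<alpha> \<beta> x y = mean (\<lambda>\<theta>. \<alpha> * (x \<theta> - mean x) * (y \<theta> - mean y) + \<beta> * deriv x \<theta> * deriv y \<theta>)
      + mean x * mean y"
    by (simp add: ip_def ip0_def pr0_def mean_def[symmetric] deriv_Vect_minus_const assms)
      (simp add: mean_def)
  \<comment> \<open>Scalars are pulled out of the products so that linearity of \<open>mean\<close>
    applies term by term.\<close>
  also have "(\<lambda>\<theta>. \<alpha> * (x \<theta> - mean x) * (y \<theta> - mean y) + \<beta> * deriv x \<theta> * deriv y \<theta>) =
      (\<lambda>\<theta>. \<alpha> * (x \<theta> * y \<theta>) - (\<alpha> * mean y) * x \<theta> - (\<alpha> * mean x) * y \<theta> + \<alpha> * mean x * mean y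
        + \<beta> * (deriv x \<theta> * deriv y \<theta>))"
    by (auto simp: algebra_simps)
  also have "mean \<dots> = \<alpha> * mean (\<lambda>\<theta>. x \<theta> * y \<theta>) - \<alpha> * mean x * mean y
      + \<beta> * mean (\<lambda>\<theta>. deriv x \<theta> * deriv y \<theta>)"
    by (simp add: mean_simps assms xy)
  also have "mean (\<lambda>\<theta>. deriv x \<theta> * deriv y \<theta>) = - mean (\<lambda>\<theta>. deriv (deriv x) \<theta> * y \<theta>)"
    using mean_by_parts[OF Vect_deriv[OF assms(1)] assms(2)] by simp
  also have "\<alpha> * mean (\<lambda>\<theta>. x \<theta> * y \<theta>) - \<alpha> * mean x * mean y
      + \<beta> * - mean (\<lambda>\<theta>. deriv (deriv x) \<theta> * y \<theta>) + mean x * mean y =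
      mean (\<lambda>\<theta>. \<alpha> * (x \<theta> * y \<theta>) - (\<alpha> * mean x) * y \<theta> - \<beta> * (deriv (deriv x) \<theta> * y \<theta>) + mean x * y \<theta>)"
    by (simp add: mean_simps assms xy)
  also have "\<dots> = mean (\<lambda>\<theta>. inertia \<alpha> \<beta> x \<theta> * y \<theta>)"
    by (simp add: inertia_def algebra_simps)
  finally show ?thesis .
qed

text \<open>Both the centred part and the second derivative have mean zero. Thus the mean of an
  adjoint value can be read off from its inertia.\<close>

lemma mean_inertia: assumes "x \<in> Vect" shows "mean (inertia \<alpha> \<beta> x) = mean x"
proof -
  have "mean (deriv (deriv x)) = 0"
    by (intro mean_DERIV[of "deriv x"] Vect_DERIV Vect_deriv assms)
  then show ?thesis
    unfolding inertia_def by (simp add: mean_simps assms)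
qed

lemma Vect_bracket: "x \<in> Vect \<Longrightarrow> y \<in> Vect \<Longrightarrow> bracket x y \<in> Vect"
  unfolding bracket_def by (intro Vect_intros)

text \<open>Only the term \<open>a * u * deriv w\<close> is integrated by parts. It yields the
  derivative of \<open>a * u\<close>, whose part \<open>a * deriv u\<close> doubles the one already
  present.\<close>

lemma mean_mult_bracket:
  assumes "a \<in> Vect" "u \<in> Vect" "w \<in> Vect"
  shows "mean (\<lambda>\<theta>. a \<theta> * bracket u w \<theta>)
    = mean (\<lambda>\<theta>. (2 * a \<theta> * deriv u \<theta> + deriv a \<theta> * u \<theta>) * w \<theta>)"
proof -
  have "deriv (\<lambda>\<theta>. a \<theta> * u \<theta>) = (\<lambda>\<theta>. deriv a \<theta> * u \<theta> + a \<theta> * deriv u \<theta>)"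
    by (rule ext, rule DERIV_imp_deriv) (auto intro!: derivative_eq_intros Vect_DERIV assms)
  then have parts: "mean (\<lambda>\<theta>. (deriv a \<theta> * u \<theta> + a \<theta> * deriv u \<theta>) * w \<theta>)
      = - mean (\<lambda>\<theta>. a \<theta> * u \<theta> * deriv w \<theta>)"
    using mean_by_parts[OF Vect_mult[OF assms(1,2)] assms(3)] by simp
  have "mean (\<lambda>\<theta>. a \<theta> * bracket u w \<theta>)
      = mean (\<lambda>\<theta>. a \<theta> * deriv u \<theta> * w \<theta> - a \<theta> * u \<theta> * deriv w \<theta>)"
    by (simp add: bracket_def algebra_simps)
  also have "\<dots> = mean (\<lambda>\<theta>. a \<theta> * deriv u \<theta> * w \<theta>)
      + mean (\<lambda>\<theta>. (deriv a \<theta> * u \<theta> + a \<theta> * deriv u \<theta>) * w \<theta>)"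
    by (subst mean_diff) (auto intro!: Vect_intros assms simp: parts)
  also have "\<dots> = mean (\<lambda>\<theta>. a \<theta> * deriv u \<theta> * w \<theta>
      + (deriv a \<theta> * u \<theta> + a \<theta> * deriv u \<theta>) * w \<theta>)"
    by (subst mean_add) (auto intro!: Vect_intros assms)
  finally show ?thesis by (simp add: algebra_simps)
qed

text \<open>The adjoint is given only by its pairings with all fields \<open>w\<close>. Rewriting
  both pairings as L2 products determines the inertia of \<open>z\<close>, with no need to invert
  the inertia operator.\<close>

lemma inertia_ad_adjoint:
  assumes "is_ad_adjoint \<alpha> \<beta> u y z" "u \<in> Vect" "y \<in> Vect"
  shows "inertia \<alpha> \<beta> z
    = (\<lambda>\<theta>. 2 * inertia \<alpha> \<beta> y \<theta> * deriv u \<theta> + deriv (inertia \<alpha> \<beta> y) \<theta> * u \<theta>)"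
proof (rule Vect_eqI_mean)
  have z: "z \<in> Vect" and adj: "\<And>w. w \<in> Vect \<Longrightarrow> ip \<alpha> \<beta> z w = ip \<alpha> \<beta> y (bracket u w)"
    using assms(1) by (auto simp: is_ad_adjoint_def)
  show "inertia \<alpha> \<beta> z \<in> Vect"
    using z by (rule Vect_inertia)
  show "(\<lambda>\<theta>. 2 * inertia \<alpha> \<beta> y \<theta> * deriv u \<theta> + deriv (inertia \<alpha> \<beta> y) \<theta> * u \<theta>) \<in> Vect"
    by (intro Vect_intros Vect_inertia assms)
  fix w assume w: "w \<in> Vect"
  have "mean (\<lambda>\<theta>. inertia \<alpha> \<beta> z \<theta> * w \<theta>) = mean (\<lambda>\<theta>. inertia \<alpha> \<beta> y \<theta> * bracket u w \<theta>)"
    using adj[OF w] by (simp add: ip_eq_mean_inertia z w assms Vect_bracket)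
  also have "\<dots> = mean (\<lambda>\<theta>. (2 * inertia \<alpha> \<beta> y \<theta> * deriv u \<theta> + deriv (inertia \<alpha> \<beta> y) \<theta> * u \<theta>) * w \<theta>)"
    by (intro mean_mult_bracket Vect_inertia assms w)
  finally show "mean (\<lambda>\<theta>. inertia \<alpha> \<beta> z \<theta> * w \<theta>)
    = mean (\<lambda>\<theta>. (2 * inertia \<alpha> \<beta> y \<theta> * deriv u \<theta> + deriv (inertia \<alpha> \<beta> y) \<theta> * u \<theta>) * w \<theta>)" .
qed

text \<open>The content of the geodesic equations at a fixed time: the first part will make the
  multiplier constant, the second is the desired equation with \<open>z\<close> in place of the time
  derivative of \<open>u\<close>.\<close>

lemma ad_adjoint_Vect0:
  assumes adj: "is_ad_adjoint \<alpha> \<beta> u (\<lambda>\<theta>. u \<theta> + l) z" and u: "u \<in> Vect0"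
  shows "mean z = 0"
    and "\<beta> * deriv (deriv z) \<theta> - \<alpha> * z \<theta>
      = \<beta> * (u \<theta> * deriv (deriv (deriv u)) \<theta> + 2 * deriv u \<theta> * deriv (deriv u) \<theta>)
        - 3 * \<alpha> * u \<theta> * deriv u \<theta> - 2 * l * deriv u \<theta>"
proof -
  have uV: "u \<in> Vect" and u0: "mean u = 0" and z: "z \<in> Vect"
    using u adj by (auto simp: Vect0_def is_ad_adjoint_def)
  define a where "a = (\<lambda>\<theta>. \<alpha> * u \<theta> - \<beta> * deriv (deriv u) \<theta> + l)"
  have aV: "a \<in> Vect"
    unfolding a_def by (intro Vect_intros uV)
  \<comment> \<open>As \<open>u\<close> has mean zero, the mean of \<open>u + l\<close> is
    \<open>l\<close>: centring removes \<open>l\<close> from the \<alpha> term, and it survives only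
    as the last summand.\<close>
  have "inertia \<alpha> \<beta> (\<lambda>\<theta>. u \<theta> + l) = a"
    by (simp add: inertia_def a_def deriv_Vect_add_const uV mean_simps u0)
  then have A: "inertia \<alpha> \<beta> z = (\<lambda>\<theta>. 2 * a \<theta> * deriv u \<theta> + deriv a \<theta> * u \<theta>)"
    using inertia_ad_adjoint[OF adj uV] by (simp add: Vect_intros uV)
  have a': "deriv a = (\<lambda>\<theta>. \<alpha> * deriv u \<theta> - \<beta> * deriv (deriv (deriv u)) \<theta>)"
    unfolding a_def
    by (rule ext, rule DERIV_imp_deriv) (auto intro!: derivative_eq_intros Vect_DERIV Vect_deriv uV)
  \<comment> \<open>An antiderivative of \<open>2 * a * deriv u + deriv a * u\<close>: the summand
    \<open>a * u\<close> accounts for \<open>deriv a * u + a * deriv u\<close>, and the others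
    integrate the remaining \<open>a * deriv u\<close> after \<open>a\<close> is expanded.\<close>
  let ?F = "\<lambda>\<theta>. a \<theta> * u \<theta> + \<alpha> / 2 * (u \<theta> * u \<theta>) - \<beta> / 2 * (deriv u \<theta> * deriv u \<theta>) + l * u \<theta>"
  have "mean (inertia \<alpha> \<beta> z) = 0"
  proof (rule mean_DERIV)
    show "?F \<in> Vect"
      by (intro Vect_intros uV aV)
    show "(?F has_real_derivative inertia \<alpha> \<beta> z \<theta>) (at \<theta>)" for \<theta>
      by (auto intro!: derivative_eq_intros Vect_DERIV Vect_deriv uV aV simp: A)
        (simp add: a_def algebra_simps)
  qed
  then show z0: "mean z = 0"
    by (simp add: mean_inertia z)
  \<comment> \<open>With \<open>mean z = 0\<close> the left-hand side is minus the inertia of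
    \<open>z\<close>.\<close>
  show "\<beta> * deriv (deriv z) \<theta> - \<alpha> * z \<theta>
      = \<beta> * (u \<theta> * deriv (deriv (deriv u)) \<theta> + 2 * deriv u \<theta> * deriv (deriv u) \<theta>)
        - 3 * \<alpha> * u \<theta> * deriv u \<theta> - 2 * l * deriv u \<theta>"
    using fun_cong[OF A, of \<theta>] unfolding a' by (simp add: inertia_def z0 a_def algebra_simps)
qed

section \<open>From fixed times to the geodesic\<close>

lemma smooth_on_time_deriv_zero_constant:
  assumes "smooth_on {0..1} l" and "\<And>t. t \<in> {0..1} \<Longrightarrow> time_deriv l t = 0" and "t \<in> {0..1}"
  shows "l t = l 0"
proof -
  have "C_on (Suc 0) {0..1} l"
    using assms(1) by (simp only: smooth_on_def)
  \<comment> \<open>\<open>vector_derivative\<close> is a choice operator and is meaningful only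
    where a derivative exists; smoothness provides it.\<close>
  then have "l differentiable at s within {0..1}" if "s \<in> {0..1}" for s
    using that by (auto intro: differentiableI)
  then have "(l has_vector_derivative 0) (at s within {0..1})" if "s \<in> {0..1}" for s
    using that assms(2) by (metis vector_derivative_works)
  then obtain c where "\<And>s. s \<in> {0..1} \<Longrightarrow> l s = c"
    using has_vector_derivative_zero_constant[of "{0..1}" l] by auto
  with assms(3) show ?thesis by simp
qed

theorem mainTheorem5:
  fixes \<alpha> \<beta> :: real
    and \<gamma> :: "real \<Rightarrow> complex \<Rightarrow> complex"
    and u :: "real \<Rightarrow> real \<Rightarrow> real"
  assumes "\<beta> \<ge> 0" and "\<alpha> > - \<beta>"
    and "normal_geodesic \<alpha> \<beta> \<gamma>"
    and "u = left_log_deriv \<gamma>"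
  shows "\<exists>l::real. \<forall>t\<in>{0..1}. \<forall>\<theta>.
     \<beta> * (deriv ^^ 2) (\<lambda>\<xi>. time_deriv (\<lambda>s. u s \<xi>) t) \<theta> - \<alpha> * time_deriv (\<lambda>s. u s \<theta>) t
     = \<beta> * (u t \<theta> * (deriv ^^ 3) (u t) \<theta> + 2 * deriv (u t) \<theta> * (deriv ^^ 2) (u t) \<theta>)
       - 3 * \<alpha> * u t \<theta> * deriv (u t) \<theta> - 2 * l * deriv (u t) \<theta>"
proof -
  from assms(3) have hor: "\<And>t. t \<in> {0..1} \<Longrightarrow> u t \<in> Vect0"
    by (simp add: normal_geodesic_def horizontal_curve_def assms(4))
  from assms(3) obtain l :: "real \<Rightarrow> real" where l: "smooth_on {0..1} l"
    and geo: "\<forall>t\<in>{0..1}. \<exists>z. is_ad_adjoint \<alpha> \<beta> (u t) (\<lambda>\<theta>. u t \<theta> + l t) z \<and>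
      (\<forall>\<theta>. time_deriv (\<lambda>s. u s \<theta>) t = pr0 z \<theta>) \<and> time_deriv l t = mean z"
    unfolding normal_geodesic_def Let_def assms(4) by blast
  have "time_deriv l t = 0" if "t \<in> {0..1}" for t
    using that geo hor ad_adjoint_Vect0(1) by metis
  with l have const: "l t = l 0" if "t \<in> {0..1}" for t
    using that smooth_on_time_deriv_zero_constant by blast
  show ?thesis
  \<comment> \<open>The multiplier is constant in time, so its initial value serves as the
    constant.\<close>
  proof (intro exI[of _ "l 0"] ballI allI)
    fix t \<theta> :: real assume t: "t \<in> {0..1}"
    with geo const obtain z where z: "is_ad_adjoint \<alpha> \<beta> (u t) (\<lambda>\<theta>. u t \<theta> + l 0) z"
      and ut: "\<And>\<theta>. time_deriv (\<lambda>s. u s \<theta>) t = pr0 z \<theta>"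
      by metis
    \<comment> \<open>The projection \<open>pr0\<close> fixes \<open>z\<close>, which has mean zero.
      The equality holds at every angle, so angular derivatives of the time derivative are those of
      \<open>z\<close>, and no derivatives are interchanged.\<close>
    have "time_deriv (\<lambda>s. u s \<theta>) t = z \<theta>" for \<theta>
      using ut ad_adjoint_Vect0(1)[OF z hor[OF t]] by (simp add: pr0_def)
    then show "\<beta> * (deriv ^^ 2) (\<lambda>\<xi>. time_deriv (\<lambda>s. u s \<xi>) t) \<theta> - \<alpha> * time_deriv (\<lambda>s. u s \<theta>) t
     = \<beta> * (u t \<theta> * (deriv ^^ 3) (u t) \<theta> + 2 * deriv (u t) \<theta> * (deriv ^^ 2) (u t) \<theta>)
       - 3 * \<alpha> * u t \<theta> * deriv (u t) \<theta> - 2 * l 0 * deriv (u t) \<theta>"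
      using ad_adjoint_Vect0(2)[OF z hor[OF t], of \<theta>]
      by (simp add: eval_nat_numeral)
  qed
qed

end
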